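(* Let $m \geq 3$ and $d \geq 1$ be integers and let $G_{\infty}=(C_m^d)_{\infty}$ be the graph defined in the context. Put $$\mu= \sqrt{2 \cdot (3^d-1) \cdot \bigl(3^d-(1+2\cos(\pi/m))^d\bigr)}.$$ Then there exists an edge-spine of $G_{\infty}$ containing at most a fraction $2\mu/(3^d-1)$ of the edges of $G_{\infty}$. Moreover $2\mu/(3^d-1)=O(\sqrt d/m)$, i.e. there is an absolute constant $C$ with $2\mu/(3^d-1)\le C\sqrt d/m$ for all $d\ge 1$, $m\ge 3$.
   Context: $C_m$ denotes the cycle on the vertex set $M=\{1,2,\ldots,m\}$ (in this cyclic order). $G_{\infty}=(C_m^d)_{\infty}$ is the graph with vertex set $M^d$ in which two distinct vertices $(i_1,\ldots,i_d)$ and $(j_1,\ldots,j_d)$ are adjacent iff for every index $s$, $i_s$ and $j_s$ are either equal or adjacent in $C_m$. A cycle in $G_\infty$ is called nontrivial if its projection along at least one of the coordinates contains the full cycle $C_m$. An edge-spine is a set of edges that intersects (i.e. shares an edge with) every nontrivial cycle. *)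

theory Defs
  imports Complex_Main "HOL-Library.FuncSet"
begin

text \<open>Edges of simple graphs are unordered pairs, i.e. sets \<open>{x, y}\<close>.
  All definitions about \<open>C\<^sub>m\<close> are meant for \<open>m \<ge> 3\<close>.\<close>

definition Cm_verts :: "nat \<Rightarrow> nat set" where
  "Cm_verts m = {1..m}"

definition Cm_edges :: "nat \<Rightarrow> nat set set" where
  "Cm_edges m = {{i, i + 1} | i. 1 \<le> i \<and> i < m} \<union> {{m, 1}}"

definition Ginf_verts :: "nat \<Rightarrow> nat \<Rightarrow> (nat \<Rightarrow> nat) set" where
  "Ginf_verts m d = {1..d} \<rightarrow>\<^sub>E Cm_verts m"

definition Ginf_edges :: "nat \<Rightarrow> nat \<Rightarrow> (nat \<Rightarrow> nat) set set" where
  "Ginf_edges m d =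
     {{x, y} | x y. x \<in> Ginf_verts m d \<and> y \<in> Ginf_verts m d \<and> x \<noteq> y \<and>
        (\<forall>s\<in>{1..d}. x s = y s \<or> {x s, y s} \<in> Cm_edges m)}"

definition cycle_edges :: "'a list \<Rightarrow> 'a set set" where
  "cycle_edges xs = {{xs ! i, xs ! (Suc i mod length xs)} | i. i < length xs}"

text \<open>A cycle is given by the list of its vertices in cyclic order, the first vertex
  not being repeated at the end.\<close>

definition is_cycle :: "'a set \<Rightarrow> 'a set set \<Rightarrow> 'a list \<Rightarrow> bool" where
  "is_cycle V E xs \<longleftrightarrow>
     length xs \<ge> 3 \<and> distinct xs \<and> set xs \<subseteq> V \<and> cycle_edges xs \<subseteq> E"

text \<open>The projection of a cycle along coordinate \<open>s\<close> has as vertices and edges the images of the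
  vertices and edges of the cycle. An edge on which coordinate \<open>s\<close> is constant is mapped to a
  singleton, which is never an edge of \<open>C\<^sub>m\<close>. Containing the full cycle is meant as containment
  of graphs, for both vertices and edges.\<close>

definition proj_verts :: "nat \<Rightarrow> (nat \<Rightarrow> nat) list \<Rightarrow> nat set" where
  "proj_verts s xs = (\<lambda>x. x s) ` set xs"

definition proj_edges :: "nat \<Rightarrow> (nat \<Rightarrow> nat) list \<Rightarrow> nat set set" where
  "proj_edges s xs = (\<lambda>e. (\<lambda>x. x s) ` e) ` cycle_edges xs"

definition nontrivial_cycle :: "nat \<Rightarrow> nat \<Rightarrow> (nat \<Rightarrow> nat) list \<Rightarrow> bool" where
  "nontrivial_cycle m d xs \<longleftrightarrow>
     is_cycle (Ginf_verts m d) (Ginf_edges m d) xs \<and>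
     (\<exists>s\<in>{1..d}. Cm_verts m \<subseteq> proj_verts s xs \<and> Cm_edges m \<subseteq> proj_edges s xs)"

definition edge_spine :: "nat \<Rightarrow> nat \<Rightarrow> (nat \<Rightarrow> nat) set set \<Rightarrow> bool" where
  "edge_spine m d S \<longleftrightarrow>
     S \<subseteq> Ginf_edges m d \<and> (\<forall>xs. nontrivial_cycle m d xs \<longrightarrow> S \<inter> cycle_edges xs \<noteq> {})"

definition mu :: "nat \<Rightarrow> nat \<Rightarrow> real" where
  "mu m d = sqrt (2 * (3 ^ d - 1) * (3 ^ d - (1 + 2 * cos (pi / real m)) ^ d))"

end

theory Submission
  imports Defs "HOL-Analysis.L2_Norm"
begin

text \<open>The function \<open>f x = (\<Prod>s. sin (\<pi> x\<^sub>s / m))\<close> vanishes as soon as some \<open>x\<^sub>s = m\<close> and is, on its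
  support, an eigenfunction of the adjacency operator with loops for the eigenvalue
  \<open>(1 + 2 cos (\<pi> / m))\<^sup>d\<close>. As in Cheeger's inequality, some superlevel set \<open>U = {f\<^sup>2 > t}\<close> has at
  most \<open>\<mu> |U|\<close> boundary edges. Cover the torus by successive translates of \<open>U\<close>, label each vertex
  by the first translate containing it, and cut the edges whose ends have different labels. An
  averaging argument over the choice of the translates bounds the number of cut edges by
  \<open>\<mu> m\<^sup>d\<close>. A cycle without cut edges lies in a single translate, which misses a hyperplane
  \<open>x\<^sub>s = a\<close> in every direction \<open>s\<close>, so the cycle is trivial.\<close>

section \<open>Superlevel sets and greedy labellings\<close>

text \<open>A layer-cake argument: integrated over \<open>t\<close>, the number of pairs cut at
  level \<open>t\<close> gives the sum of the differences, and the size of the superlevel set gives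
  the sum of \<open>u\<close>, so some level is at least as good as the average. The induction peels
  off one layer at a time.\<close>

lemma exists_threshold:
  fixes u :: "'a \<Rightarrow> real" and p q :: "'b \<Rightarrow> 'a"
  assumes "finite X" "finite P" "p ` P \<subseteq> X" "q ` P \<subseteq> X" "0 \<le> c"
    and "\<And>x. x \<in> X \<Longrightarrow> 0 \<le> u x" and "\<exists>x\<in>X. 0 < u x"
    and "(\<Sum>e\<in>P. \<bar>u (p e) - u (q e)\<bar>) \<le> c * (\<Sum>x\<in>X. u x)"
  shows "\<exists>t\<ge>0. (\<exists>x\<in>X. t < u x) \<and>
    real (card {e \<in> P. (t < u (p e)) \<noteq> (t < u (q e))}) \<le> c * real (card {x \<in> X. t < u x})"
  using assms(6-)
proof (induction "card {x \<in> X. 0 < u x}" arbitrary: u rule: less_induct)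
  case less
  let ?pos = "{x \<in> X. 0 < u x}"
  let ?cut = "{e \<in> P. (0 < u (p e)) \<noteq> (0 < u (q e))}"
  show ?case
  proof (cases "real (card ?cut) \<le> c * real (card ?pos)")
    case True
    then show ?thesis using less.prems(2) by (intro exI[of _ 0]) auto
  next
    case False
    have fin: "finite ?pos" using assms(1) by simp
    have ne: "?pos \<noteq> {}" using less.prems(2) by auto
    \<comment> \<open>The bottom layer of \<open>u\<close> lies over \<open>?pos\<close> and has
      height \<open>v\<close>, the least positive value; \<open>w\<close> is what remains above
      it.\<close>
    define v where "v = Min (u ` ?pos)"
    define w where "w x = max (u x - v) 0" for x
    have v_in: "v \<in> u ` ?pos" unfolding v_def using fin ne by (intro Min_in) auto
    have vpos: "0 < v" using v_in by auto
    have v_le: "v \<le> u x" if "x \<in> X" "0 < u x" for x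
      unfolding v_def using fin that by (intro Min_le) auto
    have u_zero: "u x = 0" if "x \<in> X" "\<not> 0 < u x" for x
      using less.prems(1)[OF that(1)] that(2) by simp
    have u_eq: "u x = w x + v * of_bool (0 < u x)" if "x \<in> X" for x
      using v_le[OF that] u_zero[OF that] vpos by (auto simp: w_def)
    have "\<bar>u (p e) - u (q e)\<bar>
        = \<bar>w (p e) - w (q e)\<bar> + v * of_bool ((0 < u (p e)) \<noteq> (0 < u (q e)))"
      if "e \<in> P" for e
    proof -
      have "p e \<in> X" "q e \<in> X" using that assms(3,4) by auto
      then show ?thesis
        using v_le[of "p e"] v_le[of "q e"] u_zero[of "p e"] u_zero[of "q e"] vpos by (auto simp: w_def)
    qed
    then have "(\<Sum>e\<in>P. \<bar>u (p e) - u (q e)\<bar>)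
        = (\<Sum>e\<in>P. \<bar>w (p e) - w (q e)\<bar>
            + v * of_bool ((0 < u (p e)) \<noteq> (0 < u (q e))))"
      by (intro sum.cong) auto
    also have "\<dots> = (\<Sum>e\<in>P. \<bar>w (p e) - w (q e)\<bar>) + v * real (card ?cut)"
      using assms(2)
      by (simp add: sum.distrib of_bool_def flip: sum_distrib_left sum.inter_filter)
    finally have sum_P: "(\<Sum>e\<in>P. \<bar>u (p e) - u (q e)\<bar>)
        = (\<Sum>e\<in>P. \<bar>w (p e) - w (q e)\<bar>) + v * real (card ?cut)" .
    have "(\<Sum>x\<in>X. u x) = (\<Sum>x\<in>X. w x + v * of_bool (0 < u x))"
      using u_eq by (intro sum.cong) auto
    also have "\<dots> = (\<Sum>x\<in>X. w x) + v * real (card ?pos)"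
      using assms(1)
      by (simp add: sum.distrib of_bool_def flip: sum_distrib_left sum.inter_filter)
    finally have sum_X: "(\<Sum>x\<in>X. u x) = (\<Sum>x\<in>X. w x) + v * real (card ?pos)" .
    \<comment> \<open>Level 0 fails, so the bottom layer has a ratio worse than \<open>c\<close>,
      and removing it makes the inequality strict. Strictness then keeps \<open>w\<close> from
      vanishing identically.\<close>
    have "v * (c * real (card ?pos)) < v * real (card ?cut)"
      using False vpos by simp
    then have less_w: "(\<Sum>e\<in>P. \<bar>w (p e) - w (q e)\<bar>) < c * (\<Sum>x\<in>X. w x)"
      using less.prems(3) unfolding sum_P sum_X by (simp add: algebra_simps)
    have w_nonneg: "0 \<le> w x" for x by (simp add: w_def)
    have w_pos: "\<exists>x\<in>X. 0 < w x"
    proof (rule ccontr)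
      assume "\<not> ?thesis"
      then have "\<And>x. x \<in> X \<Longrightarrow> w x = 0" using w_nonneg by (metis less_eq_real_def)
      then have "c * (\<Sum>x\<in>X. w x) = 0" by simp
      moreover have "0 \<le> (\<Sum>e\<in>P. \<bar>w (p e) - w (q e)\<bar>)" by (intro sum_nonneg) auto
      ultimately show False using less_w by linarith
    qed
    \<comment> \<open>A point \<open>z\<close> where \<open>v\<close> is attained leaves the
      support, so the induction measure drops.\<close>
    obtain z where z: "z \<in> ?pos" "u z = v" using v_in by auto
    have "{x \<in> X. 0 < w x} \<subset> ?pos"
    proof
      show "{x \<in> X. 0 < w x} \<subseteq> ?pos" using vpos by (auto simp: w_def)
      have "z \<notin> {x \<in> X. 0 < w x}" using z(2) by (simp add: w_def)
      then show "{x \<in> X. 0 < w x} \<noteq> ?pos" using z(1) by metis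
    qed
    then have "card {x \<in> X. 0 < w x} < card ?pos"
      using fin by (rule psubset_card_mono[rotated])
    from less.hyps[OF this w_nonneg w_pos less_imp_le[OF less_w]]
    obtain t where t: "t \<ge> 0" "\<exists>x\<in>X. t < w x"
      "real (card {e \<in> P. (t < w (p e)) \<noteq> (t < w (q e))}) \<le> c * real (card {x \<in> X. t < w x})"
      by blast
    \<comment> \<open>As \<open>0 <= t\<close>, the truncation at 0 in \<open>w\<close> does not
      affect the superlevel set.\<close>
    have "t < w x \<longleftrightarrow> t + v < u x" for x using t(1) by (auto simp: w_def)
    then show ?thesis using t vpos by (intro exI[of _ "t + v"]) auto
  qed
qed

text \<open>Choose the sets greedily; each new set claims all points not yet claimed. Every pair is
  met by at least \<open>k\<close> of the sets, so on average a set cuts at most a \<open>1 / k\<close> fraction of the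
  total weight of the pairs which it is the first to meet, where the weight of a pair is the
  number of sets cutting it.\<close>

lemma exists_labelling:
  fixes T :: "'i \<Rightarrow> 'a set" and A :: "('a \<times> 'a) set"
  assumes "finite I" "0 < k"
    and "finite V" "finite A" "A \<subseteq> V \<times> V"
    and "\<And>x. x \<in> V \<Longrightarrow> k \<le> card {g \<in> I. x \<in> T g}"
  shows "\<exists>l. (\<forall>x\<in>V. l x \<in> I \<and> x \<in> T (l x)) \<and>
    k * card {(x, y) \<in> A. l x \<noteq> l y} \<le> (\<Sum>(x, y)\<in>A. card {g \<in> I. (x \<in> T g) \<noteq> (y \<in> T g)})"
  using assms(3-)
\<comment> \<open>The induction runs over the set of points not yet claimed, with \<open>A\<close>
  the pairs inside it; the covering hypothesis passes to subsets.\<close>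
proof (induction V arbitrary: A rule: finite_psubset_induct)
  case (psubset W)
  note finA = \<open>finite A\<close>
  define wt where "wt = (\<lambda>(x, y). card {g \<in> I. (x \<in> T g) \<noteq> (y \<in> T g)})"
  define cut where "cut g = {(x, y) \<in> A. (x \<in> T g) \<noteq> (y \<in> T g)}" for g
  define met where "met g = {(x, y) \<in> A. x \<in> T g \<or> y \<in> T g}" for g
  have cut_sub: "cut g \<subseteq> A" and met_sub: "met g \<subseteq> A" for g
    by (auto simp: cut_def met_def)
  show ?case
  proof (cases "W = {}")
    case True
    then show ?thesis using psubset.prems by auto
  next
    case False
    then obtain x0 where x0: "x0 \<in> W" by blast
    have "{g \<in> I. x0 \<in> T g} \<noteq> {}"
      using psubset.prems(3)[OF x0] \<open>0 < k\<close> by (metis card.empty not_le)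
    then obtain g0 where g0: "g0 \<in> I" "x0 \<in> T g0" by blast
    have "\<exists>g\<in>I. T g \<inter> W \<noteq> {} \<and> k * card (cut g) \<le> sum wt (met g)"
    proof (rule ccontr)
      assume neg: "\<not> ?thesis"
      have "(\<Sum>g\<in>I. sum wt (met g)) < (\<Sum>g\<in>I. k * card (cut g))"
      proof (rule sum_strict_mono_ex1)
        show "\<forall>g\<in>I. sum wt (met g) \<le> k * card (cut g)"
        proof
          fix g assume "g \<in> I"
          show "sum wt (met g) \<le> k * card (cut g)"
          proof (cases "T g \<inter> W = {}")
            case True
            then have "met g = {}" using psubset.prems(2) by (auto simp: met_def)
            then show ?thesis by simp
          next
            case False
            then show ?thesis using neg \<open>g \<in> I\<close> by force
          qed
        qed
        \<comment> \<open>Sets disjoint from \<open>W\<close> contribute 0 to both sides, so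
          strictness must come from a set meeting \<open>W\<close>; \<open>g0\<close> is one, and it
          exists because \<open>0 < k\<close>.\<close>
        show "\<exists>g\<in>I. sum wt (met g) < k * card (cut g)"
          using neg g0 x0 by (intro bexI[of _ g0]) force+
      qed (use \<open>finite I\<close> in simp)
      also have "(\<Sum>g\<in>I. k * card (cut g)) = (\<Sum>g\<in>I. \<Sum>e\<in>A. if e \<in> cut g then k else 0)"
        using finA by (intro sum.cong refl) (simp add: sum.If_cases Int_absorb1[OF cut_sub])
      also have "\<dots> = (\<Sum>e\<in>A. \<Sum>g\<in>I. if e \<in> cut g then k else 0)" by (rule sum.swap)
      \<comment> \<open>A pair is cut by exactly \<open>wt e\<close> sets and met by at least
        \<open>k\<close>, namely those containing its first component. Hence the chain returns to
        the sum it started from.\<close>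
      also have "\<dots> = (\<Sum>e\<in>A. k * wt e)"
        using \<open>finite I\<close>
        by (intro sum.cong refl) (auto simp: sum.If_cases cut_def wt_def Int_def)
      also have "\<dots> \<le> (\<Sum>e\<in>A. card {g \<in> I. e \<in> met g} * wt e)"
      proof (intro sum_mono mult_right_mono)
        fix e assume "e \<in> A"
        obtain x y where e: "e = (x, y)" by (cases e)
        have "x \<in> W" using \<open>e \<in> A\<close> e psubset.prems(2) by auto
        then have "k \<le> card {g \<in> I. x \<in> T g}" by (rule psubset.prems(3))
        also have "\<dots> \<le> card {g \<in> I. e \<in> met g}"
          using \<open>finite I\<close> \<open>e \<in> A\<close> e by (intro card_mono) (auto simp: met_def)
        finally show "k \<le> card {g \<in> I. e \<in> met g}" .
      qed simp
      also have "\<dots> = (\<Sum>e\<in>A. \<Sum>g\<in>I. if e \<in> met g then wt e else 0)"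
        using \<open>finite I\<close> by (intro sum.cong refl) (simp add: sum.If_cases Int_def)
      also have "\<dots> = (\<Sum>g\<in>I. \<Sum>e\<in>A. if e \<in> met g then wt e else 0)" by (rule sum.swap)
      also have "\<dots> = (\<Sum>g\<in>I. sum wt (met g))"
        using finA by (intro sum.cong[OF refl]) (simp add: sum.If_cases Int_absorb1[OF met_sub])
      finally show False by simp
    qed
    then obtain g where g: "g \<in> I" "T g \<inter> W \<noteq> {}" "k * card (cut g) \<le> sum wt (met g)"
      by blast
    define A' where "A' = A - met g"
    have "W - T g \<subset> W" using g(2) by blast
    moreover have "A' \<subseteq> (W - T g) \<times> (W - T g)"
      using psubset.prems(2) by (auto simp: A'_def met_def)
    ultimately obtain l where l: "\<forall>x\<in>W - T g. l x \<in> I \<and> x \<in> T (l x)"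
      "k * card {(x, y) \<in> A'. l x \<noteq> l y} \<le> sum wt A'"
      using psubset.IH[of "W - T g" A'] finA psubset.prems(3)
      unfolding wt_def by (auto simp: A'_def)
    define l' where "l' x = (if x \<in> T g then g else l x)" for x
    \<comment> \<open>A pair met but not cut by \<open>T g\<close> has both ends in
      \<open>T g\<close>, so both get the label \<open>g\<close>.\<close>
    have "{(x, y) \<in> A. l' x \<noteq> l' y} \<subseteq> cut g \<union> {(x, y) \<in> A'. l x \<noteq> l y}"
      by (auto simp: l'_def cut_def A'_def met_def split: if_splits)
    then have "card {(x, y) \<in> A. l' x \<noteq> l' y} \<le> card (cut g \<union> {(x, y) \<in> A'. l x \<noteq> l y})"
      using finA by (intro card_mono) (auto simp: A'_def intro: finite_subset[OF cut_sub] finite_subset[of _ A])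
    also have "\<dots> \<le> card (cut g) + card {(x, y) \<in> A'. l x \<noteq> l y}" by (rule card_Un_le)
    finally have "k * card {(x, y) \<in> A. l' x \<noteq> l' y}
        \<le> k * card (cut g) + k * card {(x, y) \<in> A'. l x \<noteq> l y}"
      unfolding add_mult_distrib2[symmetric] by (rule mult_le_mono2)
    also have "\<dots> \<le> sum wt (met g) + sum wt A'" using g(3) l(2) by linarith
    also have "\<dots> = sum wt A"
      unfolding A'_def using sum.subset_diff[OF met_sub finA, of wt g] by (simp add: add.commute)
    finally have "k * card {(x, y) \<in> A. l' x \<noteq> l' y} \<le> sum wt A" .
    moreover have "\<forall>x\<in>W. l' x \<in> I \<and> x \<in> T (l' x)"
      using l(1) g(1) by (auto simp: l'_def)
    ultimately show ?thesis unfolding wt_def by blast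
  qed
qed

section \<open>Ordered pairs and Cheeger's estimate\<close>

text \<open>Converts the counts of ordered pairs, over which all sums run, into counts of edges:
  without loops, forgetting the order is two-to-one.\<close>

lemma card_symmetric_relation:
  assumes "finite R" "sym R" "irrefl R"
  shows "card R = 2 * card {{x, y} | x y. (x, y) \<in> R}"
proof -
  let ?E = "{{x, y} | x y. (x, y) \<in> R}"
  let ?p = "\<lambda>(x, y). {x, y}"
  have E: "?E = ?p ` R" by auto
  have "card R = (\<Sum>e\<in>?E. card {p \<in> R. ?p p = e})"
    unfolding E using assms(1) by (subst card_eq_sum, subst sum.image_gen[of R _ ?p]) auto
  also have "\<dots> = (\<Sum>e\<in>?E. 2)"
  proof (rule sum.cong)
    fix e assume "e \<in> ?E"
    then obtain x y where xy: "e = {x, y}" "(x, y) \<in> R" by blast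
    then have "x \<noteq> y" "(y, x) \<in> R" using assms(2,3) by (auto simp: irrefl_def dest: symD)
    then have "{p \<in> R. ?p p = e} = {(x, y), (y, x)}"
      using xy by (auto simp: doubleton_eq_iff)
    then show "card {p \<in> R. ?p p = e} = 2" using \<open>x \<noteq> y\<close> by simp
  qed simp
  finally show ?thesis by simp
qed

lemma sum_sym_relation_swap:
  assumes "sym R"
  shows "(\<Sum>(x, y)\<in>R. F y x) = (\<Sum>(x, y)\<in>R. F x y)"
  by (rule sum.reindex_bij_witness[where i = prod.swap and j = prod.swap])
    (use assms in \<open>auto dest: symD\<close>)

text \<open>The estimate behind Cheeger's inequality. The hypothesis on \<open>f\<close> says that it is an
  eigenfunction on its support, as for a Dirichlet eigenfunction.\<close>

lemma sum_abs_diff_squares_le: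
  fixes f :: "'a \<Rightarrow> real" and N :: "'a \<Rightarrow> 'a set"
  assumes "finite V" and N: "\<And>x. x \<in> V \<Longrightarrow> N x \<subseteq> V" "\<And>x. x \<in> V \<Longrightarrow> x \<in> N x"
    and "sym (Sigma V N)" and card_N: "\<And>x. x \<in> V \<Longrightarrow> card (N x) = D" and "0 < D"
    and eigen: "\<And>x. x \<in> V \<Longrightarrow> f x * (\<Sum>y\<in>N x. f y) = lam * (f x)\<^sup>2"
  shows "(\<Sum>(x, y)\<in>Sigma V (\<lambda>x. N x - {x}). \<bar>(f x)\<^sup>2 - (f y)\<^sup>2\<bar>)
    \<le> 2 * sqrt (2 * (real D - 1) * (real D - lam)) * (\<Sum>x\<in>V. (f x)\<^sup>2)"
proof -
  let ?A = "Sigma V (\<lambda>x. N x - {x})" and ?B = "Sigma V N"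
  define F where "F = (\<Sum>x\<in>V. (f x)\<^sup>2)"
  have fin_N: "finite (N x)" if "x \<in> V" for x using N(1)[OF that] \<open>finite V\<close> by (rule finite_subset)
  have sym_A: "sym ?A" using \<open>sym ?B\<close> by (auto intro!: symI dest: symD)
  have "F \<ge> 0" unfolding F_def by (intro sum_nonneg) auto
  have B1: "(\<Sum>(x, y)\<in>?B. (f x)\<^sup>2) = real D * F"
    using \<open>finite V\<close> fin_N card_N
    by (subst sum.Sigma[symmetric]) (auto simp: F_def sum_distrib_left)
  have A1: "(\<Sum>(x, y)\<in>?A. (f x)\<^sup>2) = (real D - 1) * F"
    using \<open>finite V\<close> fin_N card_N N(2) \<open>0 < D\<close>
    by (subst sum.Sigma[symmetric]) (auto simp: F_def sum_distrib_left of_nat_diff intro!: sum.cong)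
  have B2: "(\<Sum>(x, y)\<in>?B. (f y)\<^sup>2) = real D * F"
    using sum_sym_relation_swap[OF \<open>sym ?B\<close>, of "\<lambda>x y. (f x)\<^sup>2"] B1 by simp
  have A2: "(\<Sum>(x, y)\<in>?A. (f y)\<^sup>2) = (real D - 1) * F"
    using sum_sym_relation_swap[OF sym_A, of "\<lambda>x y. (f x)\<^sup>2"] A1 by simp
  have B3: "(\<Sum>(x, y)\<in>?B. f x * f y) = lam * F"
    using \<open>finite V\<close> fin_N eigen
    by (subst sum.Sigma[symmetric]) (auto simp: F_def sum_distrib_left[symmetric])
  \<comment> \<open>Loops contribute 0 to the energy, so it may be computed over \<open>?B\<close>,
    where the eigenvalue equation applies.\<close>
  have "(\<Sum>(x, y)\<in>?A. (f x - f y)\<^sup>2) \<le> (\<Sum>(x, y)\<in>?B. (f x - f y)\<^sup>2)"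
    using \<open>finite V\<close> fin_N by (intro sum_mono2 finite_SigmaI) auto
  also have "\<dots> = (\<Sum>(x, y)\<in>?B. (f x)\<^sup>2) + (\<Sum>(x, y)\<in>?B. (f y)\<^sup>2) - 2 * (\<Sum>(x, y)\<in>?B. f x * f y)"
    by (simp add: case_prod_unfold power2_diff sum.distrib sum_subtractf sum_distrib_left mult.assoc)
  also have "\<dots> = 2 * (real D - lam) * F" unfolding B1 B2 B3 by (simp add: algebra_simps)
  finally have minus: "(\<Sum>(x, y)\<in>?A. (f x - f y)\<^sup>2) \<le> 2 * (real D - lam) * F" .
  \<comment> \<open>Here each loop would add \<open>4 * (f x)^2\<close>; staying with
    \<open>?A\<close> gives the factor \<open>real D - 1\<close> instead of
    \<open>real D\<close>.\<close>
  have "(\<Sum>(x, y)\<in>?A. (f x + f y)\<^sup>2) \<le> (\<Sum>(x, y)\<in>?A. 2 * (f x)\<^sup>2 + 2 * (f y)\<^sup>2)"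
  proof -
    have "(f x + f y)\<^sup>2 \<le> 2 * (f x)\<^sup>2 + 2 * (f y)\<^sup>2" for x y
      using zero_le_power2[of "f x - f y"] by (simp add: power2_sum power2_diff)
    then show ?thesis by (intro sum_mono) auto
  qed
  also have "\<dots> = 2 * (\<Sum>(x, y)\<in>?A. (f x)\<^sup>2) + 2 * (\<Sum>(x, y)\<in>?A. (f y)\<^sup>2)"
    by (simp add: case_prod_unfold sum.distrib sum_distrib_left)
  also have "\<dots> = 4 * (real D - 1) * F" unfolding A1 A2 by (simp add: algebra_simps)
  finally have plus: "(\<Sum>(x, y)\<in>?A. (f x + f y)\<^sup>2) \<le> 4 * (real D - 1) * F" .
  \<comment> \<open>Factor the difference of squares and apply Cauchy-Schwarz.\<close>
  have "(\<Sum>(x, y)\<in>?A. \<bar>(f x)\<^sup>2 - (f y)\<^sup>2\<bar>)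
      = (\<Sum>e\<in>?A. \<bar>f (fst e) - f (snd e)\<bar> * \<bar>f (fst e) + f (snd e)\<bar>)"
    by (intro sum.cong refl)
      (auto simp: abs_mult[symmetric] power2_eq_square algebra_simps)
  also have "\<dots> \<le> L2_set (\<lambda>e. f (fst e) - f (snd e)) ?A * L2_set (\<lambda>e. f (fst e) + f (snd e)) ?A"
    by (rule L2_set_mult_ineq)
  also have "\<dots> = sqrt (\<Sum>(x, y)\<in>?A. (f x - f y)\<^sup>2) * sqrt (\<Sum>(x, y)\<in>?A. (f x + f y)\<^sup>2)"
    by (simp add: L2_set_def case_prod_unfold)
  also have "\<dots> \<le> sqrt (2 * (real D - lam) * F) * sqrt (4 * (real D - 1) * F)"
  proof (intro mult_mono real_sqrt_le_mono minus plus real_sqrt_ge_zero)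
    \<comment> \<open>The sign is read off from the energy bound, whose left side is a sum of
      squares.\<close>
    show "0 \<le> 2 * (real D - lam) * F"
      using minus by (rule order_trans[rotated]) (auto intro: sum_nonneg)
  qed (auto intro: sum_nonneg)
  also have "\<dots> = sqrt (2\<^sup>2 * (2 * (real D - 1) * (real D - lam)) * F\<^sup>2)"
    by (simp add: real_sqrt_mult[symmetric] power2_eq_square algebra_simps)
  also have "\<dots> = 2 * sqrt (2 * (real D - 1) * (real D - lam)) * F"
    using \<open>F \<ge> 0\<close> by (simp only: real_sqrt_mult real_sqrt_abs abs_of_nonneg abs_numeral)
  finally show ?thesis unfolding F_def .
qed

section \<open>The cycle and its sine eigenfunction\<close>

text \<open>Neighbourhoods are closed so that those of the strong product are cartesian products of
  these, and sums over them factor.\<close>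

definition nbhd :: "nat \<Rightarrow> nat \<Rightarrow> nat set" where
  "nbhd m a = {b \<in> Cm_verts m. a = b \<or> {a, b} \<in> Cm_edges m}"

lemma doubleton_in_Cm_edges:
  "{a, b} \<in> Cm_edges m \<longleftrightarrow>
    1 \<le> a \<and> a < m \<and> b = a + 1 \<or> 1 \<le> b \<and> b < m \<and> a = b + 1 \<or> a = m \<and> b = 1 \<or> a = 1 \<and> b = m"
  unfolding Cm_edges_def by (auto simp: doubleton_eq_iff)

lemma nbhd_eq:
  assumes "3 \<le> m" "a \<in> Cm_verts m"
  shows "nbhd m a = {a, if a = 1 then m else a - 1, if a = m then 1 else a + 1}"
proof (rule set_eqI)
  fix b
  show "b \<in> nbhd m a \<longleftrightarrow> b \<in> {a, if a = 1 then m else a - 1, if a = m then 1 else a + 1}"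
    using assms by (simp add: nbhd_def doubleton_in_Cm_edges Cm_verts_def) arith
qed

lemma card_nbhd:
  assumes "3 \<le> m" "a \<in> Cm_verts m"
  shows "card (nbhd m a) = 3"
  using assms unfolding nbhd_eq[OF assms] Cm_verts_def by (auto simp: card_insert_if)

text \<open>The sine changes sign under a shift of \<open>n\<close> by \<open>m\<close>; its
  absolute value is \<open>m\<close>-periodic and thus well defined on the cycle.\<close>

definition abs_sine :: "nat \<Rightarrow> nat \<Rightarrow> real" where
  "abs_sine m n = \<bar>sin (pi * real n / real m)\<bar>"

lemma sin_pi_frac_mod:
  assumes "0 < m"
  shows "sin (pi * real n / real m + t) = (- 1) ^ (n div m) * sin (pi * real (n mod m) / real m + t)"
proof -
  have "real n = real m * real (n div m) + real (n mod m)"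
    by (metis mult_div_mod_eq of_nat_add of_nat_mult)
  then have "pi * real n / real m + t = (pi * real (n mod m) / real m + t) + pi * real (n div m)"
    using assms by (simp add: field_simps)
  then have "sin (pi * real n / real m + t)
      = sin ((pi * real (n mod m) / real m + t) + pi * real (n div m))"
    by (rule arg_cong)
  also have "\<dots> = (- 1) ^ (n div m) * sin (pi * real (n mod m) / real m + t)"
    by (simp only: sin_add[of _ "pi * real (n div m)"] sin_npi2 cos_npi2) simp
  finally show ?thesis .
qed

lemma abs_sine_mod: "0 < m \<Longrightarrow> abs_sine m (n mod m) = abs_sine m n"
  using sin_pi_frac_mod[of m n 0] by (simp add: abs_sine_def abs_mult)

lemma abs_sine_cong: "0 < m \<Longrightarrow> n mod m = n' mod m \<Longrightarrow> abs_sine m n = abs_sine m n'"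
  by (metis abs_sine_mod)

text \<open>The sine changes sign only at multiples of pi, that is at multiples of \<open>m\<close>,
  and none lies strictly between \<open>n\<close> and \<open>Suc n\<close>.\<close>

lemma sin_mult_sin_Suc_nonneg:
  assumes "0 < m"
  shows "0 \<le> sin (pi * real n / real m) * sin (pi * real (Suc n) / real m)"
proof -
  let ?r = "n mod m"
  have "?r < m" using assms by simp
  then have r: "real ?r / real m \<le> 1" "(real ?r + 1) / real m \<le> 1" by (auto simp del: of_nat_mod)
  have "sin (pi * real n / real m) = (- 1) ^ (n div m) * sin (pi * (real ?r / real m))"
    using sin_pi_frac_mod[OF assms, of n 0] by simp
  \<comment> \<open>The shift by \<open>pi / real m\<close> keeps the sign
    \<open>(- 1) ^ (n div m)\<close>, even when \<open>Suc n\<close> is a multiple of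
    \<open>m\<close>.\<close>
  moreover have "sin (pi * real (Suc n) / real m)
      = (- 1) ^ (n div m) * sin (pi * ((real ?r + 1) / real m))"
    using sin_pi_frac_mod[OF assms, of n "pi / real m"]
    by (simp add: distrib_left add_divide_distrib add.commute del: of_nat_mod)
  moreover have "0 \<le> sin (pi * (real ?r / real m))" "0 \<le> sin (pi * ((real ?r + 1) / real m))"
    using r by (intro sin_ge_zero mult_left_le mult_nonneg_nonneg; simp)+
  ultimately show ?thesis
    by (simp only: mult.assoc mult.left_commute[of "sin _" "(- 1) ^ _"])
      (simp flip: mult.assoc power_add)
qed

text \<open>Neighbouring sines have compatible signs, so the absolute values drop out of the
  products and the addition formulas apply. The factor in front covers the zeros of the sine, where
  the neighbouring values may be positive.\<close>

lemma abs_sine_eigen: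
  assumes "0 < m"
  shows "abs_sine m (Suc n) * (abs_sine m (Suc n) + abs_sine m n + abs_sine m (Suc (Suc n)))
    = (1 + 2 * cos (pi / real m)) * (abs_sine m (Suc n))\<^sup>2"
proof -
  define \<theta> where "\<theta> = pi * real (Suc n) / real m"
  define \<alpha> where "\<alpha> = pi / real m"
  have n: "pi * real n / real m = \<theta> - \<alpha>" "pi * real (Suc (Suc n)) / real m = \<theta> + \<alpha>"
    unfolding \<theta>_def \<alpha>_def by (simp_all add: algebra_simps add_divide_distrib)
  have "\<bar>sin \<theta>\<bar> * \<bar>sin (\<theta> - \<alpha>)\<bar> = sin \<theta> * sin (\<theta> - \<alpha>)"
    using sin_mult_sin_Suc_nonneg[OF assms, of n] unfolding n \<theta>_def[symmetric]
    by (simp add: abs_mult[symmetric] mult.commute)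
  moreover have "\<bar>sin \<theta>\<bar> * \<bar>sin (\<theta> + \<alpha>)\<bar> = sin \<theta> * sin (\<theta> + \<alpha>)"
    using sin_mult_sin_Suc_nonneg[OF assms, of "Suc n"] unfolding n \<theta>_def[symmetric]
    by (simp add: abs_mult[symmetric])
  ultimately show ?thesis
    unfolding abs_sine_def n \<theta>_def[symmetric] \<alpha>_def[symmetric]
    by (simp add: distrib_left sin_add sin_diff power2_eq_square algebra_simps)
qed

lemma abs_sine_nbhd:
  assumes "3 \<le> m" "a \<in> Cm_verts m"
  shows "abs_sine m (a + c) * (\<Sum>b\<in>nbhd m a. abs_sine m (b + c))
    = (1 + 2 * cos (pi / real m)) * (abs_sine m (a + c))\<^sup>2"
proof -
  obtain n where n: "a + c = Suc n" using assms(2) by (cases a) (auto simp: Cm_verts_def)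
  have a: "1 \<le> a" "a \<le> m" using assms(2) by (auto simp: Cm_verts_def)
  define p where "p = (if a = 1 then m else a - 1)"
  define q where "q = (if a = m then 1 else a + 1)"
  have pred: "abs_sine m (p + c) = abs_sine m n"
    using n a assms(1) by (intro abs_sine_cong) (auto simp: p_def)
  have succ: "abs_sine m (q + c) = abs_sine m (Suc (Suc n))"
  proof (rule abs_sine_cong)
    have "Suc (Suc n) = q + c + (if a = m then m else 0)" using n by (auto simp: q_def)
    then show "(q + c) mod m = Suc (Suc n) mod m" by simp
  qed (use assms in simp)
  have "a \<noteq> p" "a \<noteq> q" "p \<noteq> q" using a assms(1) by (auto simp: p_def q_def)
  then have "(\<Sum>b\<in>nbhd m a. abs_sine m (b + c))
      = abs_sine m (a + c) + abs_sine m (p + c) + abs_sine m (q + c)"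
    unfolding nbhd_eq[OF assms] p_def[symmetric] q_def[symmetric] by simp
  then show ?thesis unfolding pred succ n using abs_sine_eigen[of m n] assms(1) by simp
qed

section \<open>The size of the fraction\<close>

text \<open>Writing \<open>(1 + 2 * cos \<alpha>) / 3 = 1 - y\<close> with \<open>y\<close> of order
  \<open>\<alpha>^2\<close>, Bernoulli's inequality bounds the spectral gap by
  \<open>D * d * y\<close>.\<close>

lemma mu_fraction_le:
  assumes "3 \<le> m" "1 \<le> d"
  shows "2 * mu m d / (3 ^ d - 1) \<le> 2 * pi * sqrt (real d) / real m"
proof -
  define \<alpha> where "\<alpha> = pi / real m"
  define y where "y = 2 * (1 - cos \<alpha>) / 3"
  define D :: real where "D = 3 ^ d"
  have "D \<ge> 3" unfolding D_def using power_increasing[OF assms(2), of "3::real"] by simp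
  have "1 - cos \<alpha> = 2 * (sin (\<alpha> / 2))\<^sup>2"
    using cos_double_sin[of "\<alpha> / 2"] by simp
  also have "\<dots> \<le> 2 * (\<alpha> / 2)\<^sup>2"
    using abs_sin_x_le_abs_x[of "\<alpha> / 2"] by (simp only: abs_le_square_iff)
  finally have y: "y \<le> \<alpha>\<^sup>2 / 3" unfolding y_def by (simp add: power2_eq_square)
  \<comment> \<open>This gives \<open>- 1 <= - y\<close>, as Bernoulli's inequality
    requires.\<close>
  have "cos \<alpha> \<ge> 0"
    unfolding \<alpha>_def using assms(1) pi_gt_zero
    by (intro cos_ge_zero) (auto simp: field_simps intro: order_trans[of _ 0])
  then have "1 + real d * (- y) \<le> (1 + - y) ^ d"
    unfolding y_def by (intro Bernoulli_inequality) (simp add: field_simps)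
  also have "(1 + - y) ^ d = (1 + 2 * cos \<alpha>) ^ d / D"
    unfolding D_def power_divide[symmetric] y_def by (simp add: field_simps)
  finally have "D - (1 + 2 * cos \<alpha>) ^ d \<le> D * (real d * y)"
    using \<open>D \<ge> 3\<close> by (simp add: field_simps)
  \<comment> \<open>\<open>D <= 3 / 2 * (D - 1)\<close> holds because \<open>D >= 3\<close>; it
    makes the radicand a perfect square times \<open>d\<close>.\<close>
  also have "\<dots> \<le> (3 / 2 * (D - 1)) * (real d * (\<alpha>\<^sup>2 / 3))"
    using \<open>D \<ge> 3\<close> y cos_le_one[of \<alpha>] by (intro mult_mono mult_left_mono) (auto simp: y_def)
  finally have "2 * (D - 1) * (D - (1 + 2 * cos \<alpha>) ^ d) \<le> 2 * (D - 1) * \<dots>"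
    using \<open>D \<ge> 3\<close> by (intro mult_left_mono) auto
  also have "\<dots> = (D - 1)\<^sup>2 * (real d * \<alpha>\<^sup>2)"
    unfolding power2_eq_square by algebra
  finally have "mu m d \<le> sqrt ((D - 1)\<^sup>2 * (real d * \<alpha>\<^sup>2))"
    unfolding mu_def D_def \<alpha>_def by (rule real_sqrt_le_mono)
  also have "\<dots> = (D - 1) * (sqrt (real d) * \<alpha>)"
    using \<open>D \<ge> 3\<close> by (simp add: real_sqrt_mult \<alpha>_def)
  finally have "2 * mu m d / (D - 1) \<le> 2 * (sqrt (real d) * \<alpha>)"
    using \<open>D \<ge> 3\<close> by (simp add: field_simps)
  then show ?thesis unfolding D_def \<alpha>_def by (simp add: field_simps)
qed

section \<open>Adjacency in the strong product\<close>

definition strong_nbhd :: "nat \<Rightarrow> nat \<Rightarrow> (nat \<Rightarrow> nat) \<Rightarrow> (nat \<Rightarrow> nat) set" where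
  "strong_nbhd m d x = (\<Pi>\<^sub>E s\<in>{1..d}. nbhd m (x s))"

definition Ginf_adj :: "nat \<Rightarrow> nat \<Rightarrow> ((nat \<Rightarrow> nat) \<times> (nat \<Rightarrow> nat)) set" where
  "Ginf_adj m d = Sigma (Ginf_verts m d) (\<lambda>x. strong_nbhd m d x - {x})"

lemma finite_Ginf_verts: "finite (Ginf_verts m d)"
  by (auto simp: Ginf_verts_def Cm_verts_def intro: finite_PiE)

lemma strong_nbhd_iff:
  assumes "x \<in> Ginf_verts m d"
  shows "y \<in> strong_nbhd m d x \<longleftrightarrow>
    y \<in> Ginf_verts m d \<and> (\<forall>s\<in>{1..d}. x s = y s \<or> {x s, y s} \<in> Cm_edges m)"
  unfolding strong_nbhd_def Ginf_verts_def nbhd_def PiE_iff by auto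

lemma sym_strong_nbhd: "sym (Sigma (Ginf_verts m d) (strong_nbhd m d))"
proof (rule symI)
  fix x y assume "(x, y) \<in> Sigma (Ginf_verts m d) (strong_nbhd m d)"
  then have x: "x \<in> Ginf_verts m d" and y: "y \<in> strong_nbhd m d x" by auto
  from y[unfolded strong_nbhd_iff[OF x]]
  have "y \<in> Ginf_verts m d" "\<forall>s\<in>{1..d}. y s = x s \<or> {y s, x s} \<in> Cm_edges m"
    by (auto simp: insert_commute)
  then show "(y, x) \<in> Sigma (Ginf_verts m d) (strong_nbhd m d)"
    using x by (simp add: strong_nbhd_iff)
qed

lemma card_strong_nbhd:
  assumes "3 \<le> m" "x \<in> Ginf_verts m d"
  shows "card (strong_nbhd m d x) = 3 ^ d"
proof -
  have "card (strong_nbhd m d x) = (\<Prod>s\<in>{1..d}. card (nbhd m (x s)))"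
    unfolding strong_nbhd_def by (rule card_PiE) simp
  also have "\<dots> = (\<Prod>s\<in>{1..d}. 3)"
    using assms by (intro prod.cong refl card_nbhd) (auto simp: Ginf_verts_def)
  finally show ?thesis by simp
qed

lemma Ginf_edges_eq: "Ginf_edges m d = {{x, y} | x y. (x, y) \<in> Ginf_adj m d}"
proof -
  have "(x, y) \<in> Ginf_adj m d \<longleftrightarrow> x \<in> Ginf_verts m d \<and> y \<in> Ginf_verts m d \<and> x \<noteq> y \<and>
      (\<forall>s\<in>{1..d}. x s = y s \<or> {x s, y s} \<in> Cm_edges m)" for x y
    unfolding Ginf_adj_def by (auto simp: strong_nbhd_iff simp del: atLeastAtMost_iff)
  then show ?thesis unfolding Ginf_edges_def by simp
qed

lemma Ginf_adj_facts:
  shows finite_Ginf_adj: "finite (Ginf_adj m d)"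
    and Ginf_adj_subset: "Ginf_adj m d \<subseteq> Ginf_verts m d \<times> Ginf_verts m d"
    and sym_Ginf_adj: "sym (Ginf_adj m d)"
    and irrefl_Ginf_adj: "irrefl (Ginf_adj m d)"
proof -
  show sub: "Ginf_adj m d \<subseteq> Ginf_verts m d \<times> Ginf_verts m d"
    unfolding Ginf_adj_def by (auto simp: strong_nbhd_iff)
  show "finite (Ginf_adj m d)"
    using sub by (rule finite_subset) (simp add: finite_Ginf_verts)
  show "sym (Ginf_adj m d)"
    using sym_strong_nbhd[of m d] unfolding Ginf_adj_def by (auto intro!: symI dest: symD)
  show "irrefl (Ginf_adj m d)" unfolding Ginf_adj_def by (auto simp: irrefl_def)
qed

lemma card_Ginf_adj:
  assumes "3 \<le> m"
  shows "real (card (Ginf_adj m d)) = real (card (Ginf_verts m d)) * (3 ^ d - 1)"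
proof -
  have "card (strong_nbhd m d x - {x}) = 3 ^ d - 1" if "x \<in> Ginf_verts m d" for x
    using that card_strong_nbhd[OF assms that] by (simp add: strong_nbhd_iff)
  moreover have "finite (strong_nbhd m d x - {x})" if "x \<in> Ginf_verts m d" for x
    using card_strong_nbhd[OF assms that] by (simp add: card_ge_0_finite)
  ultimately have "card (Ginf_adj m d) = card (Ginf_verts m d) * (3 ^ d - 1)"
    unfolding Ginf_adj_def by (simp add: finite_Ginf_verts)
  then show ?thesis by (simp add: of_nat_diff)
qed

section \<open>Translates of the product eigenfunction\<close>

text \<open>Up to the identification of \<open>m\<close> with \<open>0\<close>, the function \<open>\<lambda>x. wave m d x g\<close> is the translate
  by \<open>-g\<close> of the first Dirichlet eigenfunction of the box \<open>{1..m - 1}\<^sup>d\<close>, extended by zero.\<close>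

definition wave :: "nat \<Rightarrow> nat \<Rightarrow> (nat \<Rightarrow> nat) \<Rightarrow> (nat \<Rightarrow> nat) \<Rightarrow> real" where
  "wave m d x g = (\<Prod>s\<in>{1..d}. abs_sine m (x s + g s))"

text \<open>The sum over a product neighbourhood factors over the coordinates, so the eigenvalues
  multiply.\<close>

lemma wave_eigen:
  assumes "3 \<le> m" "x \<in> Ginf_verts m d"
  shows "wave m d x g * (\<Sum>y\<in>strong_nbhd m d x. wave m d y g)
    = (1 + 2 * cos (pi / real m)) ^ d * (wave m d x g)\<^sup>2"
proof -
  have x: "x s \<in> Cm_verts m" if "s \<in> {1..d}" for s
    using assms(2) that by (auto simp: Ginf_verts_def)
  have "(\<Sum>y\<in>strong_nbhd m d x. wave m d y g)
      = (\<Prod>s\<in>{1..d}. \<Sum>b\<in>nbhd m (x s). abs_sine m (b + g s))"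
    unfolding strong_nbhd_def wave_def
    by (rule prod_sum_PiE[symmetric]) (auto simp: nbhd_def Cm_verts_def)
  then have "wave m d x g * (\<Sum>y\<in>strong_nbhd m d x. wave m d y g)
      = (\<Prod>s\<in>{1..d}. abs_sine m (x s + g s) * (\<Sum>b\<in>nbhd m (x s). abs_sine m (b + g s)))"
    by (simp add: wave_def prod.distrib)
  also have "\<dots> = (\<Prod>s\<in>{1..d}. (1 + 2 * cos (pi / real m)) * (abs_sine m (x s + g s))\<^sup>2)"
    using abs_sine_nbhd[OF assms(1) x] by (intro prod.cong) auto
  also have "\<dots> = (1 + 2 * cos (pi / real m)) ^ d * (wave m d x g)\<^sup>2"
    by (simp add: wave_def prod.distrib prod_power_distrib)
  finally show ?thesis .
qed

lemma sum_abs_diff_wave_squares_le: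
  assumes "3 \<le> m"
  shows "(\<Sum>(x, y)\<in>Ginf_adj m d. \<bar>(wave m d x g)\<^sup>2 - (wave m d y g)\<^sup>2\<bar>)
    \<le> 2 * mu m d * (\<Sum>x\<in>Ginf_verts m d. (wave m d x g)\<^sup>2)"
  using sum_abs_diff_squares_le[OF finite_Ginf_verts _ _ sym_strong_nbhd
      card_strong_nbhd[OF assms] _ wave_eigen[OF assms]]
  by (simp add: Ginf_adj_def mu_def strong_nbhd_iff subset_iff)

text \<open>Translation by \<open>x\<close> permutes the vertices modulo \<open>m\<close>, so every
  vertex lies in equally many translates. This supplies the uniform \<open>k\<close> of
  \<open>exists_labelling\<close>.\<close>

lemma card_wave_superlevel:
  assumes "3 \<le> m" "x \<in> Ginf_verts m d"
  shows "card {g \<in> Ginf_verts m d. t < (wave m d x g)\<^sup>2}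
    = card {g \<in> Ginf_verts m d. t < (\<Prod>s\<in>{1..d}. abs_sine m (g s))\<^sup>2}"
proof -
  \<comment> \<open>Vertices are numbered from 1, so the residue 0 is represented by
    \<open>m\<close>.\<close>
  define rep where "rep n = (if n mod m = 0 then m else n mod m)" for n
  define \<phi> where "\<phi> g = (\<lambda>s\<in>{1..d}. rep (x s + g s))" for g
  have rep_mod: "rep n mod m = n mod m" for n by (simp add: rep_def)
  have rep_in: "rep n \<in> Cm_verts m" for n
    using assms(1) mod_less_divisor[of m n] by (auto simp: rep_def Cm_verts_def)
  have cancel: "a = b"
    if "(c + a) mod m = (c + b) mod m" "a \<in> {1..m}" "b \<in> {1..m}" "a \<le> b" for a b c
  proof -
    have "m dvd (c + b) - (c + a)"
      using that(1,4) by (subst mod_eq_dvd_iff_nat[symmetric]) auto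
    then have "m dvd b - a" by simp
    moreover have "b - a < m" using that(2,3) by auto
    ultimately show ?thesis using that(4) by (auto dest: nat_dvd_not_less)
  qed
  have "\<phi> ` Ginf_verts m d \<subseteq> Ginf_verts m d"
    by (auto simp: \<phi>_def Ginf_verts_def rep_in)
  moreover have inj: "inj_on \<phi> (Ginf_verts m d)"
  proof (rule inj_onI)
    fix g h assume g: "g \<in> Ginf_verts m d" and h: "h \<in> Ginf_verts m d" and eq: "\<phi> g = \<phi> h"
    have "g s = h s" if "s \<in> {1..d}" for s
    proof -
      have "rep (x s + g s) = rep (x s + h s)" using fun_cong[OF eq, of s] that by (simp add: \<phi>_def)
      then have "(x s + g s) mod m = (x s + h s) mod m" by (metis rep_mod)
      moreover have "g s \<in> {1..m}" "h s \<in> {1..m}"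
        using g h that by (auto simp: Ginf_verts_def Cm_verts_def)
      ultimately show ?thesis using cancel by (metis nle_le)
    qed
    then show "g = h" using g h unfolding Ginf_verts_def by (intro PiE_ext) auto
  qed
  ultimately have image: "\<phi> ` Ginf_verts m d = Ginf_verts m d"
    using finite_Ginf_verts by (intro endo_inj_surj)
  have wave: "wave m d x g = (\<Prod>s\<in>{1..d}. abs_sine m (\<phi> g s))" for g
    unfolding wave_def \<phi>_def using assms(1)
    by (intro prod.cong refl) (auto intro!: abs_sine_cong simp: rep_mod)
  have "{g \<in> Ginf_verts m d. t < (\<Prod>s\<in>{1..d}. abs_sine m (g s))\<^sup>2}
      = \<phi> ` {g \<in> Ginf_verts m d. t < (wave m d x g)\<^sup>2}"
    unfolding wave by (subst image[symmetric]) auto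
  then show ?thesis using inj by (simp add: card_image inj_on_subset)
qed

lemma exists_wave_nonzero:
  assumes "3 \<le> m"
  shows "\<exists>x\<in>Ginf_verts m d. \<exists>g\<in>Ginf_verts m d. 0 < (wave m d x g)\<^sup>2"
proof -
  \<comment> \<open>With \<open>x = g = e\<close> every factor is \<open>sin (2 * pi / m)\<close>,
    positive because \<open>m >= 3\<close>.\<close>
  define e :: "nat \<Rightarrow> nat" where "e = (\<lambda>s\<in>{1..d}. 1)"
  have "0 < sin (pi * 2 / real m)"
    using assms by (intro sin_gt_zero) (auto simp: field_simps)
  then have "0 < wave m d e e"
    unfolding wave_def by (intro prod_pos) (auto simp: e_def abs_sine_def numeral_2_eq_2)
  moreover have "e \<in> Ginf_verts m d" using assms by (auto simp: e_def Ginf_verts_def Cm_verts_def)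
  ultimately show ?thesis by (intro bexI[of _ e]) auto
qed

lemma wave_vanishes:
  assumes "3 \<le> m" "g \<in> Ginf_verts m d" "s \<in> {1..d}"
  shows "\<exists>a\<in>Cm_verts m. \<forall>x. x s = a \<longrightarrow> wave m d x g = 0"
proof -
  \<comment> \<open>The vertex congruent to \<open>- g s\<close> modulo \<open>m\<close>, with
    \<open>m\<close> in place of 0.\<close>
  define a where "a = (if g s = m then m else m - g s)"
  have gs: "g s \<in> {1..m}" using assms by (auto simp: Ginf_verts_def Cm_verts_def)
  then have a: "a \<in> Cm_verts m" by (auto simp: a_def Cm_verts_def)
  have "(a + g s) mod m = 0" using gs by (auto simp: a_def)
  then have "abs_sine m (a + g s) = abs_sine m 0" using assms(1) by (intro abs_sine_cong) auto
  then have "abs_sine m (a + g s) = 0" by (simp add: abs_sine_def)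
  then have "wave m d x g = 0" if "x s = a" for x
    unfolding wave_def using that assms(3) by (intro prod_zero) auto
  with a show ?thesis by blast
qed

section \<open>From labellings to edge-spines\<close>

lemma cycle_constant:
  assumes "xs \<noteq> []" and step: "\<And>x y. {x, y} \<in> cycle_edges xs \<Longrightarrow> l x = l y"
  shows "\<exists>c. \<forall>x\<in>set xs. l x = c"
proof -
  have "l (xs ! i) = l (xs ! 0)" if "i < length xs" for i
    using that
  proof (induction i)
    case (Suc i)
    then have "{xs ! i, xs ! Suc i} \<in> cycle_edges xs"
      unfolding cycle_edges_def by (auto intro!: exI[of _ i])
    then show ?case using Suc step by fastforce
  qed simp
  then show ?thesis by (metis in_set_conv_nth)
qed

text \<open>A cycle without cut edges carries a single label \<open>g\<close>. In each direction
  \<open>s\<close> the wave of \<open>g\<close> vanishes on some layer \<open>x s = a\<close>, so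
  the projection of the cycle misses \<open>a\<close>.\<close>

lemma edge_spine_of_labelling:
  assumes "3 \<le> m" "0 \<le> t"
    and l: "\<And>x. x \<in> Ginf_verts m d \<Longrightarrow> l x \<in> Ginf_verts m d \<and> t < (wave m d x (l x))\<^sup>2"
  shows "edge_spine m d {{x, y} | x y. (x, y) \<in> Ginf_adj m d \<and> l x \<noteq> l y}" (is "edge_spine m d ?S")
  unfolding edge_spine_def
proof (intro conjI allI impI)
  show "?S \<subseteq> Ginf_edges m d" unfolding Ginf_edges_eq by blast
next
  fix xs assume "nontrivial_cycle m d xs"
  then obtain s where cyc: "is_cycle (Ginf_verts m d) (Ginf_edges m d) xs"
    and s: "s \<in> {1..d}" "Cm_verts m \<subseteq> proj_verts s xs"
    unfolding nontrivial_cycle_def by blast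
  show "?S \<inter> cycle_edges xs \<noteq> {}"
  proof
    assume empty: "?S \<inter> cycle_edges xs = {}"
    have "l x = l y" if xy: "{x, y} \<in> cycle_edges xs" for x y
    proof -
      have "{x, y} \<in> Ginf_edges m d" using cyc xy by (auto simp: is_cycle_def)
      then obtain x' y' where x'y': "{x, y} = {x', y'}" "(x', y') \<in> Ginf_adj m d"
        unfolding Ginf_edges_eq by blast
      then have "l x' = l y'" using empty xy by blast
      then show ?thesis using x'y'(1) by (auto simp: doubleton_eq_iff)
    qed
    moreover have "xs \<noteq> []" using cyc by (auto simp: is_cycle_def)
    ultimately obtain g where g: "\<And>x. x \<in> set xs \<Longrightarrow> l x = g" using cycle_constant by metis
    have verts: "set xs \<subseteq> Ginf_verts m d" using cyc by (simp add: is_cycle_def)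
    have "hd xs \<in> set xs" using \<open>xs \<noteq> []\<close> by simp
    then have "g \<in> Ginf_verts m d" using l verts g by blast
    from wave_vanishes[OF assms(1) this s(1)] obtain a
      where a: "a \<in> Cm_verts m" "\<And>x. x s = a \<Longrightarrow> wave m d x g = 0" by blast
    then obtain x where x: "x \<in> set xs" "x s = a" using s(2) by (auto simp: proj_verts_def)
    have "t < (wave m d x g)\<^sup>2" using l verts g x(1) by force
    then show False using a(2)[of x] x(2) \<open>0 \<le> t\<close> by simp
  qed
qed

lemma exists_edge_spine:
  assumes "3 \<le> m" "1 \<le> d"
  shows "\<exists>S. edge_spine m d S \<and>
    real (card S) \<le> (2 * mu m d / (3 ^ d - 1)) * real (card (Ginf_edges m d))"
proof -
  define V where "V = Ginf_verts m d"
  define A where "A = Ginf_adj m d"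
  \<comment> \<open>Pairing vertices with translates lets one threshold serve all translates at
    once.\<close>
  define u where "u = (\<lambda>(x, g). (wave m d x g)\<^sup>2)"
  have finV: "finite V" unfolding V_def by (rule finite_Ginf_verts)
  have finA: "finite A" and subA: "A \<subseteq> V \<times> V"
    unfolding A_def V_def by (rule finite_Ginf_adj, rule Ginf_adj_subset)
  have "3 ^ d \<ge> (3::real)" using power_increasing[OF assms(2), of "3::real"] by simp
  have mu_nonneg: "0 \<le> mu m d"
  proof -
    have "0 \<le> cos (pi / real m)"
      using assms(1) by (intro cos_ge_zero) (auto simp: field_simps intro: order_trans[of _ 0])
    then have "(1 + 2 * cos (pi / real m)) ^ d \<le> 3 ^ d"
      using cos_le_one[of "pi / real m"] by (intro power_mono) auto
    then show ?thesis unfolding mu_def using \<open>3 ^ d \<ge> (3::real)\<close> by simp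
  qed
  have total: "(\<Sum>e\<in>A \<times> V. \<bar>u (fst (fst e), snd e) - u (snd (fst e), snd e)\<bar>)
      \<le> 2 * mu m d * (\<Sum>z\<in>V \<times> V. u z)"
  proof -
    have "(\<Sum>e\<in>A \<times> V. \<bar>u (fst (fst e), snd e) - u (snd (fst e), snd e)\<bar>)
        = (\<Sum>(e, g)\<in>A \<times> V. case e of (x, y) \<Rightarrow> \<bar>(wave m d x g)\<^sup>2 - (wave m d y g)\<^sup>2\<bar>)"
      by (simp add: u_def case_prod_unfold)
    also have "\<dots> = (\<Sum>g\<in>V. \<Sum>(x, y)\<in>A. \<bar>(wave m d x g)\<^sup>2 - (wave m d y g)\<^sup>2\<bar>)"
      by (subst sum.cartesian_product[symmetric]) (rule sum.swap)
    also have "\<dots> \<le> (\<Sum>g\<in>V. 2 * mu m d * (\<Sum>x\<in>V. (wave m d x g)\<^sup>2))"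
      unfolding A_def V_def using sum_abs_diff_wave_squares_le[OF assms(1)] by (rule sum_mono)
    also have "\<dots> = 2 * mu m d * (\<Sum>g\<in>V. \<Sum>x\<in>V. (wave m d x g)\<^sup>2)"
      by (rule sum_distrib_left[symmetric])
    also have "(\<Sum>g\<in>V. \<Sum>x\<in>V. (wave m d x g)\<^sup>2) = (\<Sum>x\<in>V. \<Sum>g\<in>V. (wave m d x g)\<^sup>2)"
      by (rule sum.swap)
    also have "\<dots> = (\<Sum>z\<in>V \<times> V. u z)"
      unfolding u_def by (rule sum.cartesian_product)
    finally show ?thesis .
  qed
  have "\<exists>t\<ge>0. (\<exists>z\<in>V \<times> V. t < u z) \<and>
      real (card {e \<in> A \<times> V. (t < u (fst (fst e), snd e)) \<noteq> (t < u (snd (fst e), snd e))})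
      \<le> 2 * mu m d * real (card {z \<in> V \<times> V. t < u z})"
  proof (rule exists_threshold[OF _ _ _ _ _ _ _ total])
    show "\<exists>z\<in>V \<times> V. 0 < u z"
      using exists_wave_nonzero[OF assms(1), of d] by (auto simp: u_def V_def)
  qed (use finV finA subA mu_nonneg in \<open>auto simp: u_def\<close>)
  then obtain t where t: "0 \<le> t" "\<exists>z\<in>V \<times> V. t < u z"
    and cut_le: "real (card {e \<in> A \<times> V. (t < u (fst (fst e), snd e)) \<noteq> (t < u (snd (fst e), snd e))})
      \<le> 2 * mu m d * real (card {z \<in> V \<times> V. t < u z})" by blast
  define T where "T g = {x \<in> V. t < u (x, g)}" for g
  \<comment> \<open>The number of translates containing a given vertex, the same for all
    vertices.\<close>
  define k where "k = card {g \<in> V. t < (\<Prod>s\<in>{1..d}. abs_sine m (g s))\<^sup>2}"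
  have k: "card {g \<in> V. t < u (x, g)} = k" if "x \<in> V" for x
    using card_wave_superlevel[OF assms(1)] that by (simp add: u_def k_def V_def)
  obtain x0 g0 where "x0 \<in> V" "g0 \<in> V" "t < u (x0, g0)" using t(2) by auto
  then have "0 < k" using k[of x0] finV by (auto simp: card_gt_0_iff)
  have card_level: "card {z \<in> V \<times> V. t < u z} = card V * k"
  proof -
    have "{z \<in> V \<times> V. t < u z} = Sigma V (\<lambda>x. {g \<in> V. t < u (x, g)})" by auto
    then show ?thesis using finV k by simp
  qed
  have card_cut: "card {e \<in> A \<times> V. (t < u (fst (fst e), snd e)) \<noteq> (t < u (snd (fst e), snd e))}
      = (\<Sum>(x, y)\<in>A. card {g \<in> V. (x \<in> T g) \<noteq> (y \<in> T g)})"
  proof -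
    have "{e \<in> A \<times> V. (t < u (fst (fst e), snd e)) \<noteq> (t < u (snd (fst e), snd e))}
        = Sigma A (\<lambda>(x, y). {g \<in> V. (x \<in> T g) \<noteq> (y \<in> T g)})"
      using subA by (auto simp: T_def)
    then show ?thesis using finA finV by (simp add: case_prod_unfold)
  qed
  obtain l where l: "\<forall>x\<in>V. l x \<in> V \<and> x \<in> T (l x)"
    and l_cut: "k * card {(x, y) \<in> A. l x \<noteq> l y}
      \<le> (\<Sum>(x, y)\<in>A. card {g \<in> V. (x \<in> T g) \<noteq> (y \<in> T g)})"
    using exists_labelling[OF finV \<open>0 < k\<close> finV finA subA, of T] k by (auto simp: T_def)
  let ?R = "{(x, y) \<in> A. l x \<noteq> l y}"
  let ?S = "{{x, y} | x y. (x, y) \<in> Ginf_adj m d \<and> l x \<noteq> l y}"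
  \<comment> \<open>The weights in \<open>l_cut\<close> add up to the pairs cut over all translates,
    at most \<open>2 * mu m d\<close> times the total size \<open>card V * k\<close> of the level
    sets; then \<open>k\<close> cancels.\<close>
  have "real (k * card ?R) \<le> 2 * mu m d * real (card V * k)"
    using order_trans[OF of_nat_mono[OF l_cut] cut_le[unfolded card_level card_cut]] .
  then have "real k * real (card ?R) \<le> real k * (2 * mu m d * real (card V))"
    by (simp add: mult_ac)
  then have R_le: "real (card ?R) \<le> 2 * mu m d * real (card V)"
    using \<open>0 < k\<close> by (simp only: mult_le_cancel_left_pos of_nat_0_less_iff)
  have card_R: "card ?R = 2 * card ?S"
  proof -
    have "?R \<subseteq> A" by auto
    then have "finite ?R" using finA by (rule finite_subset)
    moreover have "sym ?R" using sym_Ginf_adj[of m d] unfolding A_def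
      by (auto intro!: symI dest: symD)
    moreover have "irrefl ?R" by (auto simp: irrefl_def)
    ultimately show ?thesis using card_symmetric_relation[of ?R] by (simp add: A_def)
  qed
  have "real (card A) = 2 * real (card (Ginf_edges m d))"
    unfolding A_def Ginf_edges_eq
    using card_symmetric_relation[OF finite_Ginf_adj sym_Ginf_adj irrefl_Ginf_adj, of m d] by simp
  moreover have "real (card A) = real (card V) * (3 ^ d - 1)"
    unfolding A_def V_def by (rule card_Ginf_adj[OF assms(1)])
  ultimately have card_E: "real (card (Ginf_edges m d)) = real (card V) * (3 ^ d - 1) / 2" by simp
  \<comment> \<open>Edges and cut edges are each half of the corresponding ordered pairs, so the
    factors 2 agree.\<close>
  have "(2 * mu m d / (3 ^ d - 1)) * real (card (Ginf_edges m d)) = mu m d * real (card V)"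
    unfolding card_E using \<open>3 ^ d \<ge> (3::real)\<close> by simp
  then have "real (card ?S) \<le> (2 * mu m d / (3 ^ d - 1)) * real (card (Ginf_edges m d))"
    using R_le card_R by simp
  moreover have "edge_spine m d ?S"
    using assms(1) t(1) l by (intro edge_spine_of_labelling) (auto simp: T_def u_def V_def)
  ultimately show ?thesis by blast
qed

theorem theorem1:
  "(\<forall>m\<ge>3. \<forall>d\<ge>1. \<exists>S. edge_spine m d S \<and>
      real (card S) \<le> (2 * mu m d / (3 ^ d - 1)) * real (card (Ginf_edges m d))) \<and>
   (\<exists>C::real. \<forall>m\<ge>3. \<forall>d\<ge>1. 2 * mu m d / (3 ^ d - 1) \<le> C * sqrt (real d) / real m)"
  using exists_edge_spine mu_fraction_le by blast

end
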